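(* (Minkowski--Voronoi complex stabilization.) Let $a\ge 1$ and $\alpha\ge 1$ be integers and let $\beta,\gamma$ be integers with $$0\le \beta<\alpha a,\qquad 0\le\gamma<a,\qquad \gcd(\alpha,\beta)=1,\qquad \gcd(a,\alpha+\beta\gamma)=1 .$$ For nonnegative integers $t,u$ put $$b(t)=\alpha a t+\beta,\qquad N(t,u)=b(t)(au+\gamma)+\alpha=(\alpha a t+\beta)(au+\gamma)+\alpha,$$ and consider only parameter values $t\ge 0$ with $0<\alpha<b(t)$ (automatic for $t\ge 1$; for $t=0$ it means $\alpha<\beta$). Then: (1) ($(t,u)$-stabilization) there exist $t_0$ and $u_0$ such that for all $t>t_0$ and $u>u_0$ the complexes $MV\big(\Gamma(a,b(t),N(t,u))\big)$ and $MV\big(\Gamma(a,b(t_0),N(t_0,u_0))\big)$ are combinatorially equivalent; (2) ($t$-stabilization) for every $u\ge 0$ there exists $t_0$ such that for every $t>t_0$ the complexes $MV\big(\Gamma(a,b(t),N(t,u))\big)$ and $MV\big(\Gamma(a,b(t_0),N(t_0,u))\big)$ are combinatorially equivalent; (3) ($u$-stabilization) for every admissible $t\ge 0$ there exists $u_0$ such that for every $u>u_0$ the complexes $MV\big(\Gamma(a,b(t),N(t,u))\big)$ and $MV\big(\Gamma(a,b(t),N(t,u_0))\big)$ are combinatorially equivalent.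
   Context: For positive integers $a,b,N$ the rank-1 lattice is $\Gamma(a,b,N)=\{m_1(1,a,b)+m_2(0,N,0)+m_3(0,0,N): m_i\in\mathbb Z\}\subset\mathbb R^3$, and $|\Gamma|=\{(|x_1|,|x_2|,|x_3|):(x_1,x_2,x_3)\in\Gamma\}\setminus\{0\}\subset\mathbb R^3_{\ge0}$. For a finite set $A\subset\mathbb R^3_{\ge 0}$ let $\Pi(A)=\{(x_1,x_2,x_3): 0\le x_i\le \max\{y_i:(y_1,y_2,y_3)\in A\},\ i=1,2,3\}$. For a set $S\subset\mathbb R^3_{\ge0}$, a point $\gamma\in S$ is a Voronoi relative minimum if $\Pi(\{\gamma\})$ contains no point of $S\setminus\{\gamma\}$; $\mathrm{vrm}(S)$ denotes the set of these. A finite $F\subset \mathrm{vrm}(S)$ is minimal if $\Pi(F)$ contains no point of $\mathrm{vrm}(S)\setminus F$; $\mathfrak M_k(S)$ is the set of minimal $k$-element subsets. The Minkowski--Voronoi complex $MV(S)$ is the 2-dimensional complex whose $k$-dimensional faces are indexed by $\mathfrak M_{3-k}(S)$ ($k=0,1,2$), a face with subset $F_1$ being adjacent to a face with subset $F_2\neq F_1$ iff $F_1\subset F_2$. For a lattice $\Gamma$ with $\mathrm{vrm}(|\Gamma|)$ finite, $MV(\Gamma)$ denotes $MV(\mathrm{vrm}(|\Gamma|))$. Two such complexes are combinatorially equivalent if there is a bijection between their faces preserving dimension and adjacency (inclusion). *)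

theory Defs
  imports "HOL-Analysis.Analysis"
begin

definition rank1_lattice :: "int \<Rightarrow> int \<Rightarrow> int \<Rightarrow> (real^3) set" where
  "rank1_lattice a b N =
     {of_int m1 *\<^sub>R vector [1, of_int a, of_int b]
      + of_int m2 *\<^sub>R vector [0, of_int N, 0]
      + of_int m3 *\<^sub>R vector [0, 0, of_int N] | m1 m2 m3 :: int. True}"

definition abs_set :: "(real^3) set \<Rightarrow> (real^3) set" where
  "abs_set \<Gamma> = (\<lambda>x. \<chi> i. \<bar>x $ i\<bar>) ` \<Gamma> - {0}"

(* Meaningful only for finite nonempty A. *)
definition Pi_box :: "(real^3) set \<Rightarrow> (real^3) set" where
  "Pi_box A = {x. \<forall>i. 0 \<le> x $ i \<and> x $ i \<le> Max ((\<lambda>y. y $ i) ` A)}"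

definition vrm :: "(real^3) set \<Rightarrow> (real^3) set" where
  "vrm S = {\<gamma> \<in> S. Pi_box {\<gamma>} \<inter> (S - {\<gamma>}) = {}}"

definition minimal_subset :: "(real^3) set \<Rightarrow> (real^3) set \<Rightarrow> bool" where
  "minimal_subset S F \<longleftrightarrow> finite F \<and> F \<subseteq> vrm S \<and> Pi_box F \<inter> (vrm S - F) = {}"

definition minimal_subsets :: "nat \<Rightarrow> (real^3) set \<Rightarrow> (real^3) set set" where
  "minimal_subsets k S = {F. minimal_subset S F \<and> card F = k}"

(* An abstract complex: faces C k is the set of k-dimensional faces. *)
record 'f face_complex =
  faces :: "nat \<Rightarrow> 'f set"
  adjacent :: "'f \<Rightarrow> 'f \<Rightarrow> bool"

definition MV :: "(real^3) set \<Rightarrow> (real^3) set face_complex" where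
  "MV S = \<lparr> faces = (\<lambda>k. if k \<le> 2 then minimal_subsets (3 - k) S else {}),
            adjacent = (\<lambda>F1 F2. F1 \<noteq> F2 \<and> F1 \<subseteq> F2) \<rparr>"

definition MV_lattice :: "(real^3) set \<Rightarrow> (real^3) set face_complex" where
  "MV_lattice \<Gamma> = MV (vrm (abs_set \<Gamma>))"

definition combinatorially_equivalent :: "'f face_complex \<Rightarrow> 'g face_complex \<Rightarrow> bool" where
  "combinatorially_equivalent C D \<longleftrightarrow>
     (\<exists>f. bij_betw f (\<Union>k. faces C k) (\<Union>k. faces D k) \<and>
          (\<forall>k. \<forall>F \<in> faces C k. f F \<in> faces D k) \<and>
          (\<forall>F1 \<in> (\<Union>k. faces C k). \<forall>F2 \<in> (\<Union>k. faces C k).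
             adjacent C F1 F2 \<longleftrightarrow> adjacent D (f F1) (f F2)))"

end

theory Submission
  imports Defs
begin

text \<open>
  Put \<open>c = a u + \<gamma>\<close>, so that \<open>N = b c + \<alpha>\<close>. The vectors \<open>(1, a, b)\<close>, \<open>(- c, - a c, \<alpha>)\<close> and
  \<open>(0, N, 0)\<close> form a basis of the lattice. A relative minimum \<open>x\<close> dominates neither of the
  first two, nor \<open>N\<close> times a unit vector, unless it has the same absolute coordinates. Hence all
  \<open>\<bar>x\<^sub>i\<bar> \<le> N\<close>, and \<open>x\<close> lies in one of the four regions \<open>\<bar>x\<^sub>3\<bar> \<le> \<alpha>\<close>; \<open>\<bar>x\<^sub>2\<bar> \<le> a\<close>;
  \<open>\<bar>x\<^sub>3\<bar> \<le> b\<close> and \<open>\<bar>x\<^sub>2\<bar> \<le> a c\<close>; \<open>\<bar>x\<^sub>3\<bar> \<le> b\<close> and \<open>\<bar>x\<^sub>1\<bar> \<le> c\<close>. In each region Cramer's rule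
  shows that the coefficients of \<open>x\<close> in the basis have the form \<open>n\<^sub>0 + n\<^sub>1 u\<close>, \<open>l\<^sub>0 + l\<^sub>1 t\<close>, \<open>k\<close>
  with integers bounded independently of \<open>t\<close> and \<open>u\<close>. So all relative minima belong to finitely many
  families of lattice points, with \<open>x\<^sub>1\<close> and \<open>x\<^sub>2\<close> in the span of \<open>1, c, b c\<close> and \<open>x\<^sub>3\<close> in the
  span of \<open>1, b, b c\<close>. Comparisons of absolute values of such functions are eventually constant in
  all three regimes, and they determine the complex. If \<open>c = 0\<close>, then \<open>N = \<alpha>\<close> and the lattice
  does not depend on \<open>t\<close>.
\<close>

section \<open>Relative minima and order isomorphisms\<close>

lemma abs_set_eq: "abs_set \<Gamma> = abs ` \<Gamma> - {0}"
  by (simp add: abs_set_def abs_vec_def)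

lemma abs_set_nonneg: "x \<in> abs_set \<Gamma> \<Longrightarrow> 0 \<le> x"
  by (auto simp: abs_set_eq)

lemma mem_vrm_iff_minimal:
  assumes "\<And>x. x \<in> S \<Longrightarrow> 0 \<le> x"
  shows "v \<in> vrm S \<longleftrightarrow> v \<in> S \<and> (\<forall>w\<in>S. w \<le> v \<longrightarrow> w = v)"
proof -
  have "w \<in> Pi_box {v} \<longleftrightarrow> w \<le> v" if "w \<in> S" for w
    using assms[OF that] by (simp add: Pi_box_def less_eq_vec_def)
  then show ?thesis
    unfolding vrm_def by blast
qed

lemma vrm_subset: "vrm S \<subseteq> S"
  by (auto simp: vrm_def)

lemma vrm_idem: "vrm (vrm S) = vrm S"
  by (auto simp: vrm_def)

lemma sum_floor_strict_mono_vec: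
  fixes x y :: "real^'n"
  assumes "x < y" "\<And>i. x $ i \<in> \<int>" "\<And>i. y $ i \<in> \<int>"
  shows "(\<Sum>i\<in>UNIV. \<lfloor>x $ i\<rfloor>) < (\<Sum>i\<in>UNIV. \<lfloor>y $ i\<rfloor>)"
proof (rule sum_strict_mono_ex1)
  show "\<forall>i\<in>UNIV. \<lfloor>x $ i\<rfloor> \<le> \<lfloor>y $ i\<rfloor>"
    using \<open>x < y\<close> by (simp add: less_vec_def less_eq_vec_def floor_mono)
  obtain i where "x $ i < y $ i"
    using \<open>x < y\<close> by (auto simp: less_vec_def less_eq_vec_def not_le)
  then have "\<lfloor>x $ i\<rfloor> < \<lfloor>y $ i\<rfloor>"
    using assms(2,3)[of i] by (auto elim!: Ints_cases)
  then show "\<exists>i\<in>UNIV. \<lfloor>x $ i\<rfloor> < \<lfloor>y $ i\<rfloor>"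
    by blast
qed simp

lemma vrm_below:
  assumes nonneg: "\<And>x. x \<in> S \<Longrightarrow> 0 \<le> x"
    and ints: "\<And>x i. x \<in> S \<Longrightarrow> x $ i \<in> \<int>"
    and "x \<in> S"
  obtains v where "v \<in> vrm S" "v \<le> x"
proof -
  let ?size = "\<lambda>y :: real^3. nat (\<Sum>i\<in>UNIV. \<lfloor>y $ i\<rfloor>)"
  obtain v where v: "v \<in> S" "v \<le> x"
    and least: "\<And>w. w \<in> S \<Longrightarrow> w \<le> x \<Longrightarrow> ?size v \<le> ?size w"
    using ex_has_least_nat[of "\<lambda>y. y \<in> S \<and> y \<le> x" x ?size] \<open>x \<in> S\<close> by blast
  have "w = v" if w: "w \<in> S" "w \<le> v" for w
  proof (rule ccontr)
    assume "w \<noteq> v"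
    then have "(\<Sum>i\<in>UNIV. \<lfloor>w $ i\<rfloor>) < (\<Sum>i\<in>UNIV. \<lfloor>v $ i\<rfloor>)"
      using w v ints by (intro sum_floor_strict_mono_vec) auto
    moreover have "0 \<le> (\<Sum>i\<in>UNIV. \<lfloor>w $ i\<rfloor>)"
      using nonneg[OF w(1)] by (simp add: less_eq_vec_def sum_nonneg)
    ultimately have "?size w < ?size v"
      by simp
    moreover have "?size v \<le> ?size w"
      using least w v(2) order_trans by blast
    ultimately show False
      by linarith
  qed
  then have "v \<in> vrm S"
    using v(1) by (simp add: mem_vrm_iff_minimal[OF nonneg])
  with v(2) show thesis
    by (rule that[rotated])
qed

lemma vrm_eq_between:
  assumes nonneg: "\<And>x. x \<in> S \<Longrightarrow> 0 \<le> x"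
    and ints: "\<And>x i. x \<in> S \<Longrightarrow> x $ i \<in> \<int>"
    and "vrm S \<subseteq> T" "T \<subseteq> S"
  shows "vrm T = vrm S"
proof
  show "vrm S \<subseteq> vrm T"
    using assms(3,4) by (auto simp: vrm_def)
  show "vrm T \<subseteq> vrm S"
  proof
    fix x assume x: "x \<in> vrm T"
    then have "x \<in> S"
      using vrm_subset \<open>T \<subseteq> S\<close> by blast
    then obtain v where v: "v \<in> vrm S" "v \<le> x"
      using vrm_below[OF nonneg ints] by blast
    have "v = x"
      using x v assms(3,4) nonneg mem_vrm_iff_minimal[of T x] by blast
    with v show "x \<in> vrm S"
      by simp
  qed
qed

definition coordwise_order_iso :: "(real^'n \<Rightarrow> real^'n) \<Rightarrow> (real^'n) set \<Rightarrow> (real^'n) set \<Rightarrow> bool" where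
  "coordwise_order_iso f S T \<longleftrightarrow>
     bij_betw f S T \<and> (\<forall>x\<in>S. \<forall>y\<in>S. \<forall>i. f x $ i \<le> f y $ i \<longleftrightarrow> x $ i \<le> y $ i)"

lemma coordwise_order_iso_le_iff:
  "coordwise_order_iso f S T \<Longrightarrow> x \<in> S \<Longrightarrow> y \<in> S \<Longrightarrow> f x \<le> f y \<longleftrightarrow> x \<le> y"
  by (simp add: coordwise_order_iso_def less_eq_vec_def)

lemma coordwise_order_iso_indexed:
  fixes g h :: "'j \<Rightarrow> real^'n"
  assumes le_iff: "\<And>j k i. j \<in> J \<Longrightarrow> k \<in> J \<Longrightarrow> g j $ i \<le> g k $ i \<longleftrightarrow> h j $ i \<le> h k $ i"
  shows "\<exists>f. coordwise_order_iso f (g ` J) (h ` J)"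
proof -
  define f where "f = h \<circ> inv_into J g"
  have eq_iff: "g j = g k \<longleftrightarrow> h j = h k" if "j \<in> J" "k \<in> J" for j k
    using le_iff[OF that] le_iff[OF that(2,1)] by (simp add: vec_eq_iff order_eq_iff)
  have f: "f (g j) = h j" if "j \<in> J" for j
    using that eq_iff[of "inv_into J g (g j)" j] by (simp add: f_def inv_into_into f_inv_into_f)
  have "bij_betw f (g ` J) (h ` J)"
    using eq_iff f by (simp add: bij_betw_def inj_on_def image_image)
  then have "coordwise_order_iso f (g ` J) (h ` J)"
    using le_iff f by (simp add: coordwise_order_iso_def)
  then show ?thesis
    by blast
qed

lemma coordwise_order_iso_vrm:
  assumes iso: "coordwise_order_iso f S T"
    and nonneg: "\<And>x. x \<in> S \<Longrightarrow> 0 \<le> x" "\<And>x. x \<in> T \<Longrightarrow> 0 \<le> x"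
  shows "f ` vrm S = vrm T"
proof -
  have inj: "inj_on f S" and im: "T = f ` S"
    using iso by (auto simp: coordwise_order_iso_def bij_betw_def)
  have "f x \<in> vrm T \<longleftrightarrow> x \<in> vrm S" if "x \<in> S" for x
  proof -
    have "f x \<in> vrm T \<longleftrightarrow> (\<forall>w\<in>S. f w \<le> f x \<longrightarrow> f w = f x)"
      using that by (simp add: mem_vrm_iff_minimal[OF nonneg(2)] im)
    also have "\<dots> \<longleftrightarrow> (\<forall>w\<in>S. w \<le> x \<longrightarrow> w = x)"
      using that by (simp add: coordwise_order_iso_le_iff[OF iso] inj_on_eq_iff[OF inj])
    also have "\<dots> \<longleftrightarrow> x \<in> vrm S"
      using that by (simp add: mem_vrm_iff_minimal[OF nonneg(1)])
    finally show ?thesis .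
  qed
  then show ?thesis
    using im vrm_subset[of S] vrm_subset[of T] by blast
qed

lemma mem_Pi_box_iff:
  assumes "finite F" "F \<noteq> {}" "0 \<le> x"
  shows "x \<in> Pi_box F \<longleftrightarrow> (\<forall>i. \<exists>y\<in>F. x $ i \<le> y $ i)"
  using assms by (auto simp: Pi_box_def Max_ge_iff less_eq_vec_def)

lemma coordwise_order_iso_Pi_box:
  assumes iso: "coordwise_order_iso f S T" and "F \<subseteq> S" "x \<in> S" "finite F" "F \<noteq> {}" "0 \<le> x" "0 \<le> f x"
  shows "f x \<in> Pi_box (f ` F) \<longleftrightarrow> x \<in> Pi_box F"
proof -
  have "f x \<in> Pi_box (f ` F) \<longleftrightarrow> (\<forall>i. \<exists>y\<in>F. f x $ i \<le> f y $ i)"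
    using assms by (simp add: mem_Pi_box_iff)
  also have "\<dots> \<longleftrightarrow> (\<forall>i. \<exists>y\<in>F. x $ i \<le> y $ i)"
    using iso \<open>F \<subseteq> S\<close> \<open>x \<in> S\<close> unfolding coordwise_order_iso_def by (metis subsetD)
  finally show ?thesis
    using assms by (simp add: mem_Pi_box_iff)
qed

lemma coordwise_order_iso_minimal_subset:
  assumes iso: "coordwise_order_iso f S T"
    and nonneg: "\<And>x. x \<in> S \<Longrightarrow> 0 \<le> x" "\<And>x. x \<in> T \<Longrightarrow> 0 \<le> x"
    and F: "F \<subseteq> S" "F \<noteq> {}"
  shows "minimal_subset T (f ` F) \<longleftrightarrow> minimal_subset S F"
proof -
  have inj: "inj_on f S" and im: "T = f ` S"
    using iso by (auto simp: coordwise_order_iso_def bij_betw_def)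
  have vrm: "vrm T = f ` vrm S"
    using coordwise_order_iso_vrm[OF iso nonneg] by simp
  have "finite (f ` F) \<longleftrightarrow> finite F"
    using F inj by (simp add: finite_image_iff inj_on_subset)
  moreover have "f ` F \<subseteq> f ` vrm S \<longleftrightarrow> F \<subseteq> vrm S"
    using inj_on_image_subset_iff[OF inj] F(1) vrm_subset by blast
  moreover have "Pi_box (f ` F) \<inter> (f ` vrm S - f ` F) = {} \<longleftrightarrow> Pi_box F \<inter> (vrm S - F) = {}"
    if "finite F"
  proof -
    have box: "f x \<in> Pi_box (f ` F) \<longleftrightarrow> x \<in> Pi_box F" if "x \<in> vrm S" for x
    proof -
      have "x \<in> S"
        using that vrm_subset by blast
      then show ?thesis
        using \<open>finite F\<close> F nonneg im by (intro coordwise_order_iso_Pi_box[OF iso]) auto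
    qed
    have "f ` vrm S - f ` F = f ` (vrm S - F)"
      using inj_on_image_set_diff[OF inj] F(1) vrm_subset[of S] by auto
    then show ?thesis
      using box by (simp only:) blast
  qed
  ultimately show ?thesis
    unfolding minimal_subset_def vrm by auto
qed

section \<open>Equivalence of Minkowski--Voronoi complexes\<close>

lemma combinatorially_equivalent_refl: "combinatorially_equivalent C C"
  unfolding combinatorially_equivalent_def by (rule exI[of _ id]) auto

lemma MV_vrm: "MV (vrm S) = MV S"
proof -
  have "minimal_subsets k (vrm S) = minimal_subsets k S" for k
    by (simp add: minimal_subsets_def minimal_subset_def vrm_idem)
  then show ?thesis
    by (simp add: MV_def cong: if_cong)
qed

lemma mem_faces_MV_iff:
  "F \<in> faces (MV S) k \<longleftrightarrow> k \<le> 2 \<and> minimal_subset S F \<and> card F = 3 - k"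
  by (simp add: MV_def minimal_subsets_def)

lemma faces_MV_subset: "F \<in> faces (MV S) k \<Longrightarrow> F \<subseteq> S"
  using vrm_subset[of S] by (auto simp: mem_faces_MV_iff minimal_subset_def)

lemma coordwise_order_iso_faces_MV:
  assumes iso: "coordwise_order_iso f S T"
    and nonneg: "\<And>x. x \<in> S \<Longrightarrow> 0 \<le> x" "\<And>x. x \<in> T \<Longrightarrow> 0 \<le> x"
    and F: "F \<subseteq> S"
  shows "f ` F \<in> faces (MV T) k \<longleftrightarrow> F \<in> faces (MV S) k"
proof (cases "F = {}")
  case False
  have "card (f ` F) = card F"
    using iso F by (auto simp: coordwise_order_iso_def bij_betw_def intro: card_image inj_on_subset)
  then show ?thesis
    using coordwise_order_iso_minimal_subset[OF iso nonneg F False] by (simp add: mem_faces_MV_iff)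
qed (auto simp: mem_faces_MV_iff)

lemma MV_equivalent_of_coordwise_order_iso:
  assumes iso: "coordwise_order_iso f S T"
    and nonneg: "\<And>x. x \<in> S \<Longrightarrow> 0 \<le> x" "\<And>x. x \<in> T \<Longrightarrow> 0 \<le> x"
  shows "combinatorially_equivalent (MV S) (MV T)"
  unfolding combinatorially_equivalent_def
proof (intro exI[of _ "(`) f"] conjI allI ballI)
  have inj: "inj_on f S" and im: "T = f ` S"
    using iso by (auto simp: coordwise_order_iso_def bij_betw_def)
  note face_iff = coordwise_order_iso_faces_MV[OF iso nonneg]
  show face: "f ` F \<in> faces (MV T) k" if "F \<in> faces (MV S) k" for F k
    using that face_iff faces_MV_subset by blast
  have sub: "F \<subseteq> S" if "F \<in> (\<Union>k. faces (MV S) k)" for F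
    using that faces_MV_subset by blast
  show "bij_betw ((`) f) (\<Union>k. faces (MV S) k) (\<Union>k. faces (MV T) k)"
  proof (rule bij_betw_imageI)
    show "inj_on ((`) f) (\<Union>k. faces (MV S) k)"
      using inj_on_image_Pow[OF inj] by (rule inj_on_subset) (use sub in auto)
    show "(`) f ` (\<Union>k. faces (MV S) k) = (\<Union>k. faces (MV T) k)"
    proof (intro equalityI subsetI)
      fix G assume "G \<in> (\<Union>k. faces (MV T) k)"
      then obtain k where G: "G \<in> faces (MV T) k" by auto
      then obtain F where "F \<subseteq> S" "G = f ` F"
        using faces_MV_subset im by (metis subset_image_iff)
      then show "G \<in> (`) f ` (\<Union>k. faces (MV S) k)"
        using G face_iff by auto
    qed (use face in blast)
  qed
  fix F G assume "F \<in> (\<Union>k. faces (MV S) k)" "G \<in> (\<Union>k. faces (MV S) k)"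
  then have "F \<subseteq> S" "G \<subseteq> S"
    by (simp_all only: sub)
  then show "adjacent (MV S) F G \<longleftrightarrow> adjacent (MV T) (f ` F) (f ` G)"
    using inj_on_image_subset_iff[OF inj] inj_on_image_eq_iff[OF inj] by (simp add: MV_def)
qed

lemma MV_equivalent_of_indexed:
  fixes g h :: "'j \<Rightarrow> real^3"
  assumes le_iff: "\<And>j k i. j \<in> J \<Longrightarrow> k \<in> J \<Longrightarrow> \<bar>g j\<bar> $ i \<le> \<bar>g k\<bar> $ i \<longleftrightarrow> \<bar>h j\<bar> $ i \<le> \<bar>h k\<bar> $ i"
    and zero: "\<And>j. j \<in> J \<Longrightarrow> g j = 0 \<longleftrightarrow> h j = 0"
  shows "combinatorially_equivalent (MV (abs_set (g ` J))) (MV (abs_set (h ` J)))"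
proof -
  define J' where "J' = {j \<in> J. g j \<noteq> 0}"
  have "abs_set (g ` J) = (\<lambda>j. \<bar>g j\<bar>) ` J'" "abs_set (h ` J) = (\<lambda>j. \<bar>h j\<bar>) ` J'"
    using zero by (auto simp: abs_set_eq J'_def)
  moreover obtain f where "coordwise_order_iso f ((\<lambda>j. \<bar>g j\<bar>) ` J') ((\<lambda>j. \<bar>h j\<bar>) ` J')"
    using coordwise_order_iso_indexed[of J' "\<lambda>j. \<bar>g j\<bar>" "\<lambda>j. \<bar>h j\<bar>"] le_iff by (auto simp: J'_def)
  ultimately show ?thesis
    using abs_set_nonneg by (intro MV_equivalent_of_coordwise_order_iso) auto
qed

section \<open>Eventually constant comparisons\<close>

definition eventually_constant :: "'p filter \<Rightarrow> ('p \<Rightarrow> 'b) \<Rightarrow> bool" where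
  "eventually_constant F f \<longleftrightarrow> (\<forall>\<^sub>F (p, q) in F \<times>\<^sub>F F. f p = f q)"

lemma eventually_constantI:
  assumes "\<forall>\<^sub>F p in F. f p = y"
  shows "eventually_constant F f"
  unfolding eventually_constant_def eventually_prod_same
  by (intro exI[of _ "\<lambda>p. f p = y"]) (simp add: assms)

lemma eventually_constant_compose2:
  assumes "eventually_constant F f" "eventually_constant F g"
  shows "eventually_constant F (\<lambda>p. h (f p) (g p))"
  using assms unfolding eventually_constant_def by eventually_elim auto

definition affine_span :: "('p \<Rightarrow> real) \<Rightarrow> ('p \<Rightarrow> real) \<Rightarrow> ('p \<Rightarrow> real) set" where
  "affine_span X Y = {\<lambda>p. A + B * X p + C * Y p | A B C. True}"

lemma affine_spanI: "(\<And>p. f p = A + B * X p + C * Y p) \<Longrightarrow> f \<in> affine_span X Y"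
  unfolding affine_span_def by blast

lemma affine_span_add:
  assumes "f \<in> affine_span X Y" "g \<in> affine_span X Y"
  shows "(\<lambda>p. f p + g p) \<in> affine_span X Y"
proof -
  obtain A B C A' B' C' where "f = (\<lambda>p. A + B * X p + C * Y p)" "g = (\<lambda>p. A' + B' * X p + C' * Y p)"
    using assms by (auto simp: affine_span_def)
  then show ?thesis
    by (intro affine_spanI[where A = "A + A'" and B = "B + B'" and C = "C + C'"])
      (simp add: algebra_simps)
qed

lemma affine_span_cmult:
  assumes "f \<in> affine_span X Y"
  shows "(\<lambda>p. r * f p) \<in> affine_span X Y"
proof -
  obtain A B C where "f = (\<lambda>p. A + B * X p + C * Y p)"
    using assms by (auto simp: affine_span_def)
  then show ?thesis
    by (intro affine_spanI[where A = "r * A" and B = "r * B" and C = "r * C"])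
      (simp add: algebra_simps)
qed

lemma affine_span_diff:
  assumes "f \<in> affine_span X Y" "g \<in> affine_span X Y"
  shows "(\<lambda>p. f p - g p) \<in> affine_span X Y"
  using affine_span_add[OF assms(1) affine_span_cmult[OF assms(2), of "- 1"]] by simp

definition sgn_eventually_constant :: "'p filter \<Rightarrow> ('p \<Rightarrow> real) set \<Rightarrow> bool" where
  "sgn_eventually_constant F V \<longleftrightarrow> (\<forall>f\<in>V. eventually_constant F (\<lambda>p. sgn (f p)))"

lemma eventually_constant_abs_le:
  assumes "sgn_eventually_constant F (affine_span X Y)" "f \<in> affine_span X Y" "g \<in> affine_span X Y"
  shows "eventually_constant F (\<lambda>p. \<bar>f p\<bar> \<le> \<bar>g p\<bar>)"
proof -
  have abs_le_iff_sgn: "\<bar>x\<bar> \<le> \<bar>y\<bar> \<longleftrightarrow> sgn (x - y) * sgn (x + y) \<le> 0" for x y :: real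
  proof -
    have "\<bar>x\<bar> \<le> \<bar>y\<bar> \<longleftrightarrow> (x - y) * (x + y) \<le> 0"
      by (simp add: abs_le_square_iff power2_eq_square algebra_simps)
    then show ?thesis
      by (simp flip: sgn_mult)
  qed
  have "eventually_constant F (\<lambda>p. sgn (f p - g p))"
    and "eventually_constant F (\<lambda>p. sgn (f p + g p))"
    using assms(1) affine_span_diff[OF assms(2,3)] affine_span_add[OF assms(2,3)]
    by (auto simp: sgn_eventually_constant_def)
  then have "eventually_constant F (\<lambda>p. sgn (f p - g p) * sgn (f p + g p) \<le> 0)"
    by (rule eventually_constant_compose2[where h = "\<lambda>r s. r * s \<le> 0"])
  then show ?thesis
    by (simp add: abs_le_iff_sgn)
qed

lemma eventually_constant_sgn_at_top:
  assumes "filterlim f at_top F"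
  shows "eventually_constant F (\<lambda>p. sgn (f p :: real))"
proof (rule eventually_constantI)
  have "\<forall>\<^sub>F p in F. 0 < f p"
    using assms unfolding filterlim_at_top_dense by blast
  then show "\<forall>\<^sub>F p in F. sgn (f p) = 1"
    by (rule eventually_mono) simp
qed

lemma eventually_constant_sgn_uminus:
  "eventually_constant F (\<lambda>p. sgn (- f p :: real)) \<Longrightarrow> eventually_constant F (\<lambda>p. sgn (f p))"
  by (simp add: eventually_constant_def sgn_minus)

lemma eventually_constant_sgn_affine:
  fixes A B :: real
  assumes X: "filterlim X at_top F"
  shows "eventually_constant F (\<lambda>p. sgn (A + B * X p))"
proof -
  have pos: "eventually_constant F (\<lambda>p. sgn (A + B * X p))" if "B > 0" for A B :: real
    using that by (intro eventually_constant_sgn_at_top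
        filterlim_tendsto_add_at_top[OF tendsto_const]
        filterlim_tendsto_pos_mult_at_top[OF tendsto_const _ X])
  consider "B > 0" | "B = 0" | "- B > 0"
    by linarith
  then show ?thesis
  proof cases
    case 2
    then show ?thesis
      by (intro eventually_constantI[of _ "sgn A"]) simp
  next
    case 3
    have "eventually_constant F (\<lambda>p. sgn (- (A + B * X p)))"
      using pos[OF 3, of "- A"] by simp
    then show ?thesis
      by (rule eventually_constant_sgn_uminus)
  qed (rule pos)
qed

lemma sgn_eventually_constant_linear_functions:
  assumes X: "filterlim X at_top F"
    and Y: "\<And>p. Y p = r + s * X p" and Z: "\<And>p. Z p = r' + s' * X p"
  shows "sgn_eventually_constant F (affine_span Y Z)"
proof -
  have "eventually_constant F (\<lambda>p. sgn (A + B * Y p + C * Z p))" for A B C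
    using eventually_constant_sgn_affine[OF X, of "A + B * r + C * r'" "B * s + C * s'"]
    by (simp add: Y Z algebra_simps)
  then show ?thesis
    by (auto simp: sgn_eventually_constant_def affine_span_def)
qed

text \<open>There is no analogue for the span of \<open>1\<close>, \<open>X\<close> and \<open>Y\<close>: the sign of \<open>X - Y\<close> need not settle.\<close>

lemma sgn_eventually_constant_product:
  assumes X: "filterlim X at_top F" and Y: "filterlim Y at_top F"
  shows "sgn_eventually_constant F (affine_span X (\<lambda>p. X p * Y p))"
proof -
  have "eventually_constant F (\<lambda>p. sgn (A + B * X p + C * (X p * Y p)))" for A B C
  proof (cases "C = 0")
    case True
    then show ?thesis
      using eventually_constant_sgn_affine[OF X] by simp
  next
    case False
    have "filterlim (\<lambda>p. X p * (B / C + Y p)) at_top F"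
      by (intro filterlim_at_top_mult_at_top[OF X] filterlim_tendsto_add_at_top[OF tendsto_const Y])
    then have "eventually_constant F (\<lambda>p. sgn (A + C * (X p * (B / C + Y p))))"
      by (rule eventually_constant_sgn_affine)
    then show ?thesis
      using False by (simp add: algebra_simps)
  qed
  then show ?thesis
    by (auto simp: sgn_eventually_constant_def affine_span_def)
qed

lemma filterlim_of_int_affine:
  fixes t :: "'p \<Rightarrow> int"
  assumes "filterlim t at_top F" "0 < A"
  shows "filterlim (\<lambda>p. real_of_int (A * t p + B)) at_top F"
proof -
  have "filterlim (\<lambda>p. real_of_int (t p)) at_top F"
    using filterlim_real_of_int_at_top assms(1) by (rule filterlim_compose)
  then have "filterlim (\<lambda>p. real_of_int B + real_of_int A * real_of_int (t p)) at_top F"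
    using assms(2) by (intro filterlim_tendsto_add_at_top[OF tendsto_const]
        filterlim_tendsto_pos_mult_at_top[OF tendsto_const]) simp
  then show ?thesis
    by (simp add: add.commute)
qed

lemma eventually_gt_of_int_affine:
  fixes t :: "'p \<Rightarrow> int"
  assumes "filterlim t at_top F" "0 < A"
  shows "\<forall>\<^sub>F p in F. C < A * t p + B"
proof -
  have "\<forall>\<^sub>F p in F. real_of_int C < real_of_int (A * t p + B)"
    using filterlim_of_int_affine[OF assms] unfolding filterlim_at_top_dense by blast
  then show ?thesis
    by (simp only: of_int_less_iff)
qed

lemma sequentially_stabilizes:
  assumes "\<forall>\<^sub>F n in sequentially. P n"
    and "\<forall>\<^sub>F (m, n) in sequentially \<times>\<^sub>F sequentially. R m n"
  shows "\<exists>n0. P n0 \<and> (\<forall>n>n0. R n n0)"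
proof -
  obtain k where k: "\<And>n. n \<ge> k \<Longrightarrow> P n"
    using assms(1) by (auto simp: eventually_sequentially)
  obtain l where l: "\<And>m n. m \<ge> l \<Longrightarrow> n \<ge> l \<Longrightarrow> R m n"
    using assms(2) by (auto simp: eventually_prod_sequentially)
  show ?thesis
    using k l by (intro exI[of _ "max k l"]) auto
qed

section \<open>Rank-1 lattices\<close>

definition int_vec3 :: "int \<Rightarrow> int \<Rightarrow> int \<Rightarrow> real^3" where
  "int_vec3 x y z = vector [of_int x, of_int y, of_int z]"

lemma int_vec3_nth [simp]:
  "int_vec3 x y z $ 1 = of_int x" "int_vec3 x y z $ 2 = of_int y" "int_vec3 x y z $ 3 = of_int z"
  by (simp_all add: int_vec3_def)

lemma abs_int_vec3: "\<bar>int_vec3 x y z\<bar> = int_vec3 \<bar>x\<bar> \<bar>y\<bar> \<bar>z\<bar>"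
  by (simp add: vec_eq_iff abs_vec_def forall_3)

lemma int_vec3_le_iff: "int_vec3 x y z \<le> int_vec3 x' y' z' \<longleftrightarrow> x \<le> x' \<and> y \<le> y' \<and> z \<le> z'"
  by (simp add: less_eq_vec_def forall_3)

lemma int_vec3_eq_0_iff: "int_vec3 x y z = 0 \<longleftrightarrow> x = 0 \<and> y = 0 \<and> z = 0"
  by (simp add: vec_eq_iff forall_3)

lemma int_vec3_nth_Ints: "int_vec3 x y z $ i \<in> \<int>"
  using exhaust_3[of i] by auto

lemma rank1_lattice_eq:
  "rank1_lattice a b N = {int_vec3 x y z | x y z. N dvd y - a * x \<and> N dvd z - b * x}"
proof -
  have "of_int m *\<^sub>R vector [1, of_int a, of_int b] + of_int k *\<^sub>R vector [0, of_int N, 0]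
      + of_int l *\<^sub>R vector [0, 0, of_int N] = int_vec3 m (a * m + N * k) (b * m + N * l)" for m k l
    by (simp add: vec_eq_iff forall_3 mult.commute)
  moreover have "N dvd y - a * x \<longleftrightarrow> (\<exists>k. y = a * x + N * k)" for x y a
    by (auto simp: dvd_def algebra_simps)
  ultimately show ?thesis
    unfolding rank1_lattice_def by auto
qed

lemma int_vec3_in_rank1_latticeI:
  "N dvd y - a * x \<Longrightarrow> N dvd z - b * x \<Longrightarrow> int_vec3 x y z \<in> rank1_lattice a b N"
  by (auto simp: rank1_lattice_eq)

lemma rank1_lattice_cong:
  assumes "N dvd b - b'"
  shows "rank1_lattice a b N = rank1_lattice a b' N"
proof -
  have "N dvd z - b * x \<longleftrightarrow> N dvd z - b' * x" for x z
  proof -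
    have "z - b' * x = (z - b * x) + (b - b') * x"
      by (simp add: algebra_simps)
    then show ?thesis
      using assms by (metis dvd_add_left_iff dvd_mult2)
  qed
  then show ?thesis
    by (simp add: rank1_lattice_eq)
qed

lemma vrm_abs_set_minimal:
  assumes "\<bar>int_vec3 x1 x2 x3\<bar> \<in> vrm (abs_set \<Gamma>)"
    and "int_vec3 z1 z2 z3 \<in> \<Gamma>" "z1 \<noteq> 0 \<or> z2 \<noteq> 0 \<or> z3 \<noteq> 0"
    and "\<bar>z1\<bar> \<le> \<bar>x1\<bar>" "\<bar>z2\<bar> \<le> \<bar>x2\<bar>" "\<bar>z3\<bar> \<le> \<bar>x3\<bar>"
  shows "\<bar>x1\<bar> \<le> \<bar>z1\<bar> \<and> \<bar>x2\<bar> \<le> \<bar>z2\<bar> \<and> \<bar>x3\<bar> \<le> \<bar>z3\<bar>"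
proof -
  have "\<bar>int_vec3 z1 z2 z3\<bar> \<in> abs_set \<Gamma>"
    using assms(2,3) by (auto simp: abs_set_eq int_vec3_eq_0_iff)
  moreover have "\<bar>int_vec3 z1 z2 z3\<bar> \<le> \<bar>int_vec3 x1 x2 x3\<bar>"
    using assms(4-6) by (simp add: abs_int_vec3 int_vec3_le_iff)
  ultimately have "\<bar>int_vec3 x1 x2 x3\<bar> \<le> \<bar>int_vec3 z1 z2 z3\<bar>"
    using assms(1) mem_vrm_iff_minimal[OF abs_set_nonneg] by force
  then show ?thesis
    by (simp add: abs_int_vec3 int_vec3_le_iff)
qed

lemma axis_in_rank1_lattice:
  "int_vec3 N 0 0 \<in> rank1_lattice a b N" "int_vec3 0 N 0 \<in> rank1_lattice a b N"
  "int_vec3 0 0 N \<in> rank1_lattice a b N"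
  by (auto intro!: int_vec3_in_rank1_latticeI)

lemma vrm_rank1_lattice_le:
  assumes "0 < N" and x: "\<bar>int_vec3 x1 x2 x3\<bar> \<in> vrm (abs_set (rank1_lattice a b N))"
  shows "\<bar>x1\<bar> \<le> N" "\<bar>x2\<bar> \<le> N" "\<bar>x3\<bar> \<le> N"
proof -
  note axes = axis_in_rank1_lattice[THEN vrm_abs_set_minimal[OF x]]
  show "\<bar>x1\<bar> \<le> N"
    using axes(1) \<open>0 < N\<close> by (cases "N \<le> \<bar>x1\<bar>") simp_all
  show "\<bar>x2\<bar> \<le> N"
    using axes(2) \<open>0 < N\<close> by (cases "N \<le> \<bar>x2\<bar>") simp_all
  show "\<bar>x3\<bar> \<le> N"
    using axes(3) \<open>0 < N\<close> by (cases "N \<le> \<bar>x3\<bar>") simp_all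
qed

lemma vrm_rank1_lattice_first_zero:
  assumes "0 < N" and x: "\<bar>int_vec3 0 x2 x3\<bar> \<in> vrm (abs_set (rank1_lattice a b N))"
    and "N dvd x2"
  shows "x2 = 0 \<or> x3 = 0"
proof (cases "x2 = 0")
  case False
  then have "N \<le> \<bar>x2\<bar>"
    using \<open>N dvd x2\<close> \<open>0 < N\<close> by (simp add: zdvd_imp_le)
  then have "\<bar>x3\<bar> \<le> \<bar>0\<bar>"
    using vrm_abs_set_minimal[OF x axis_in_rank1_lattice(2)] \<open>0 < N\<close> by simp
  then show ?thesis
    by simp
qed simp

lemma vrm_rank1_lattice_cases:
  assumes "1 \<le> a" "1 \<le> \<alpha>" "\<alpha> \<le> b" "1 \<le> c"
    and x: "\<bar>int_vec3 x1 x2 x3\<bar> \<in> vrm (abs_set (rank1_lattice a b (b * c + \<alpha>)))"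
    and dvd: "b * c + \<alpha> dvd x2 - a * x1"
  obtains "\<bar>x3\<bar> \<le> \<alpha>" | "\<bar>x2\<bar> \<le> a" | "\<bar>x3\<bar> \<le> b" "\<bar>x2\<bar> \<le> a * c" | "\<bar>x3\<bar> \<le> b" "\<bar>x1\<bar> \<le> c"
proof -
  let ?\<Gamma> = "rank1_lattice a b (b * c + \<alpha>)"
  have "0 < b * c + \<alpha>"
    using assms(2-4) by (simp add: add_nonneg_pos)
  have "int_vec3 1 a b \<in> ?\<Gamma>"
    by (auto intro!: int_vec3_in_rank1_latticeI)
  from vrm_abs_set_minimal[OF x this] have "\<bar>x2\<bar> \<le> a \<or> \<bar>x3\<bar> \<le> b" if "x1 \<noteq> 0"
    using that assms(1-3) by linarith
  moreover have "\<bar>x2\<bar> \<le> a \<or> \<bar>x3\<bar> \<le> \<alpha>" if "x1 = 0"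
  proof -
    have "x2 = 0 \<or> x3 = 0"
      using vrm_rank1_lattice_first_zero[OF \<open>0 < b * c + \<alpha>\<close>] x dvd that by simp
    then show ?thesis
      using assms(1,2) by auto
  qed
  moreover have "int_vec3 c (a * c) (- \<alpha>) \<in> ?\<Gamma>"
    by (rule int_vec3_in_rank1_latticeI) (simp_all add: dvd_def, algebra)
  from vrm_abs_set_minimal[OF x this] have "\<bar>x1\<bar> \<le> c \<or> \<bar>x2\<bar> \<le> a * c \<or> \<bar>x3\<bar> \<le> \<alpha>"
    using assms(1-4) mult_nonneg_nonneg[of a c] by (simp add: abs_mult) linarith
  ultimately show thesis
    using that by blast
qed

text \<open>Coordinates \<open>n, l, k\<close> refer to the basis \<open>(1, a, b)\<close>, \<open>(- c, - a c, \<alpha>)\<close>, \<open>(0, b c + \<alpha>, 0)\<close>.\<close>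

definition lattice_vector :: "int \<Rightarrow> int \<Rightarrow> int \<Rightarrow> int \<Rightarrow> int \<Rightarrow> int \<Rightarrow> int \<Rightarrow> real^3" where
  "lattice_vector a \<alpha> b c n l k =
     int_vec3 (n - c * l) (a * (n - c * l) + (b * c + \<alpha>) * k) (b * n + \<alpha> * l)"

lemma rank1_lattice_eq_lattice_vectors:
  "rank1_lattice a b (b * c + \<alpha>) = {lattice_vector a \<alpha> b c n l k | n l k. True}"
proof (intro equalityI subsetI)
  fix v assume "v \<in> rank1_lattice a b (b * c + \<alpha>)"
  then obtain x k l where "v = int_vec3 x (a * x + (b * c + \<alpha>) * k) (b * x + (b * c + \<alpha>) * l)"
    unfolding rank1_lattice_eq dvd_def by (auto simp: diff_eq_eq add.commute)
  then have "v = lattice_vector a \<alpha> b c (x + c * l) l k"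
    by (simp add: lattice_vector_def algebra_simps)
  then show "v \<in> {lattice_vector a \<alpha> b c n l k | n l k. True}"
    by blast
next
  fix v assume "v \<in> {lattice_vector a \<alpha> b c n l k | n l k. True}"
  then obtain n l k where v: "v = lattice_vector a \<alpha> b c n l k"
    by blast
  have "b * n + \<alpha> * l - b * (n - c * l) = (b * c + \<alpha>) * l"
    by (simp add: algebra_simps)
  then show "v \<in> rank1_lattice a b (b * c + \<alpha>)"
    unfolding v lattice_vector_def by (intro int_vec3_in_rank1_latticeI) simp_all
qed

section \<open>Coordinates of relative minima\<close>

lemma abs_le_of_combination:
  fixes N p q x y z X Y B :: int
  assumes "0 < N" "N * z = p * x + q * y" "0 \<le> p" "0 \<le> q" "\<bar>x\<bar> \<le> X" "\<bar>y\<bar> \<le> Y"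
    and "p * X + q * Y \<le> N * B"
  shows "\<bar>z\<bar> \<le> B"
proof -
  have "N * \<bar>z\<bar> = \<bar>p * x + q * y\<bar>"
    using \<open>0 < N\<close> by (simp add: abs_mult flip: assms(2))
  also have "\<dots> \<le> p * \<bar>x\<bar> + q * \<bar>y\<bar>"
    using assms(3,4) abs_triangle_ineq[of "p * x" "q * y"] by (simp add: abs_mult)
  also have "\<dots> \<le> p * X + q * Y"
    using assms(3-6) by (intro add_mono mult_left_mono)
  also have "\<dots> \<le> N * B"
    by fact
  finally show ?thesis
    using \<open>0 < N\<close> by simp
qed

locale relative_minimum =
  fixes a \<alpha> b c n l k :: int
  assumes a_ge_1: "1 \<le> a" and \<alpha>_ge_1: "1 \<le> \<alpha>" and \<alpha>_le_b: "\<alpha> \<le> b" and c_ge_1: "1 \<le> c"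
    and minimal: "\<bar>lattice_vector a \<alpha> b c n l k\<bar> \<in> vrm (abs_set (rank1_lattice a b (b * c + \<alpha>)))"
begin

definition N :: int where "N = b * c + \<alpha>"
definition x1 :: int where "x1 = n - c * l"
definition x2 :: int where "x2 = a * x1 + N * k"
definition x3 :: int where "x3 = b * n + \<alpha> * l"

lemma minimal_coordinates: "\<bar>int_vec3 x1 x2 x3\<bar> \<in> vrm (abs_set (rank1_lattice a b N))"
  using minimal by (simp add: lattice_vector_def N_def x1_def x2_def x3_def)

lemma b_ge_1: "1 \<le> b"
  using \<alpha>_ge_1 \<alpha>_le_b by linarith

lemma N_pos: "0 < N"
  using \<alpha>_ge_1 b_ge_1 c_ge_1 by (simp add: N_def add_nonneg_pos)

lemmas coordinates_le = vrm_rank1_lattice_le[OF N_pos minimal_coordinates]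

lemma le_N: "b * c \<le> N" "b \<le> N" "\<alpha> * c \<le> N"
proof -
  show "b * c \<le> N"
    using \<alpha>_ge_1 by (simp add: N_def)
  then show "b \<le> N"
    using mult_left_mono[OF c_ge_1, of b] b_ge_1 by linarith
  show "\<alpha> * c \<le> N"
    using mult_right_mono[OF \<alpha>_le_b, of c] c_ge_1 \<open>b * c \<le> N\<close> by linarith
qed

lemma a_mult_le_N: "a * (b * c) \<le> a * N" "a * b \<le> a * N" "a * (\<alpha> * c) \<le> a * N"
  using a_ge_1 le_N by (simp_all only: mult_left_mono)

lemma k_le:
  "\<bar>k\<bar> \<le> 1 + a"
proof (rule abs_le_of_combination[OF N_pos])
  show "N * k = 1 * x2 + a * (- x1)"
    by (simp add: x1_def x2_def x3_def N_def algebra_simps)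
  show "1 * N + a * N \<le> N * (1 + a)"
    by (simp add: algebra_simps)
qed (use a_ge_1 coordinates_le in auto)

lemma n_le_of_x3_le_\<alpha>:
  assumes "\<bar>x3\<bar> \<le> \<alpha>"
  shows "\<bar>n\<bar> \<le> \<alpha> + 1"
proof (rule abs_le_of_combination[OF N_pos])
  show "N * n = \<alpha> * x1 + c * x3"
    by (simp add: x1_def x2_def x3_def N_def algebra_simps)
  show "\<alpha> * N + c * \<alpha> \<le> N * (\<alpha> + 1)"
    using le_N by (simp add: algebra_simps)
qed (use assms \<alpha>_ge_1 c_ge_1 coordinates_le in auto)

lemma al_bk_le_of_x2_le_a:
  assumes "\<bar>x2\<bar> \<le> a"
  shows "\<bar>a * l - b * k\<bar> \<le> 2 * a"
proof (rule abs_le_of_combination[OF N_pos])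
  show "N * (a * l - b * k) = a * x3 + b * (- x2)"
    by (simp add: x1_def x2_def x3_def N_def algebra_simps)
  show "a * N + b * a \<le> N * (2 * a)"
    using a_mult_le_N(2) by (simp add: algebra_simps)
qed (use assms a_ge_1 b_ge_1 coordinates_le in auto)

lemma al_bk_le_of_x2_le_ac:
  assumes "\<bar>x3\<bar> \<le> b" "\<bar>x2\<bar> \<le> a * c"
  shows "\<bar>a * l - b * k\<bar> \<le> 2 * a"
proof (rule abs_le_of_combination[OF N_pos])
  show "N * (a * l - b * k) = a * x3 + b * (- x2)"
    by (simp add: x1_def x2_def x3_def N_def algebra_simps)
  show "a * b + b * (a * c) \<le> N * (2 * a)"
    using a_mult_le_N(1,2) by (simp add: algebra_simps)
qed (use assms a_ge_1 b_ge_1 in auto)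

lemma an_\<alpha>k_le_of_x2_le_ac:
  assumes "\<bar>x3\<bar> \<le> b" "\<bar>x2\<bar> \<le> a * c"
  shows "\<bar>a * n + \<alpha> * k\<bar> \<le> 2 * a"
proof (rule abs_le_of_combination[OF N_pos])
  show "N * (a * n + \<alpha> * k) = \<alpha> * x2 + a * c * x3"
    by (simp add: x1_def x2_def x3_def N_def algebra_simps)
  show "\<alpha> * (a * c) + a * c * b \<le> N * (2 * a)"
    using a_mult_le_N(1,3) by (simp add: algebra_simps)
qed (use assms a_ge_1 \<alpha>_ge_1 c_ge_1 in auto)

lemma n_le_of_x1_le_c:
  assumes "\<bar>x3\<bar> \<le> b" "\<bar>x1\<bar> \<le> c"
  shows "\<bar>n\<bar> \<le> 2"
proof (rule abs_le_of_combination[OF N_pos])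
  show "N * n = \<alpha> * x1 + c * x3"
    by (simp add: x1_def x2_def x3_def N_def algebra_simps)
  show "\<alpha> * c + c * b \<le> N * 2"
    using le_N by (simp add: algebra_simps)
qed (use assms \<alpha>_ge_1 c_ge_1 in auto)

lemma l_le_of_x1_le_c:
  assumes "\<bar>x3\<bar> \<le> b" "\<bar>x1\<bar> \<le> c"
  shows "\<bar>l\<bar> \<le> 2"
proof (rule abs_le_of_combination[OF N_pos])
  show "N * l = 1 * x3 + b * (- x1)"
    by (simp add: x1_def x2_def x3_def N_def algebra_simps)
  show "1 * b + b * c \<le> N * 2"
    using le_N by simp
qed (use assms b_ge_1 in auto)

lemma cases:
  obtains (x3_le_\<alpha>) "\<bar>n\<bar> \<le> \<alpha> + 1" "\<bar>x3\<bar> \<le> \<alpha>"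
  | (x2_le_a) "\<bar>x2\<bar> \<le> a" "\<bar>a * l - b * k\<bar> \<le> 2 * a"
  | (x2_le_ac) "\<bar>a * n + \<alpha> * k\<bar> \<le> 2 * a" "\<bar>a * l - b * k\<bar> \<le> 2 * a"
  | (x1_le_c) "\<bar>n\<bar> \<le> 2" "\<bar>l\<bar> \<le> 2"
proof (rule vrm_rank1_lattice_cases[OF a_ge_1 \<alpha>_ge_1 \<alpha>_le_b c_ge_1])
  show "\<bar>int_vec3 x1 x2 x3\<bar> \<in> vrm (abs_set (rank1_lattice a b (b * c + \<alpha>)))"
    using minimal_coordinates by (simp add: N_def)
  show "b * c + \<alpha> dvd x2 - a * x1"
    by (simp add: x2_def N_def)
qed (use that n_le_of_x3_le_\<alpha> al_bk_le_of_x2_le_a al_bk_le_of_x2_le_ac an_\<alpha>k_le_of_x2_le_ac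
    n_le_of_x1_le_c l_le_of_x1_le_c in blast)+

end

definition bounded_affine_values :: "int \<Rightarrow> int \<Rightarrow> int set" where
  "bounded_affine_values K s = {x0 + x1 * s | x0 x1. \<bar>x0\<bar> \<le> K \<and> \<bar>x1\<bar> \<le> K}"

lemma bounded_affine_valuesI:
  assumes "\<bar>x - x1 * s\<bar> \<le> K" "\<bar>x1\<bar> \<le> K"
  shows "x \<in> bounded_affine_values K s"
proof -
  have "x = (x - x1 * s) + x1 * s"
    by simp
  then show ?thesis
    using assms unfolding bounded_affine_values_def by blast
qed

lemma bounded_affine_values_const:
  assumes "\<bar>x\<bar> \<le> K"
  shows "x \<in> bounded_affine_values K s"
  using assms by (intro bounded_affine_valuesI[where ?x1.0 = 0]) auto

type_synonym coefficients = "(int \<times> int) \<times> (int \<times> int) \<times> int"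

locale lattice_family =
  fixes a \<alpha> \<beta> \<gamma> :: int
  assumes a_ge_1: "1 \<le> a" and \<alpha>_ge_1: "1 \<le> \<alpha>" and \<beta>_nonneg: "0 \<le> \<beta>" and \<gamma>_nonneg: "0 \<le> \<gamma>"
begin

definition b_at :: "int \<Rightarrow> int" where
  "b_at t = \<alpha> * a * t + \<beta>"

definition c_at :: "int \<Rightarrow> int" where
  "c_at u = a * u + \<gamma>"

definition lattice_at :: "int \<Rightarrow> int \<Rightarrow> (real^3) set" where
  "lattice_at t u = rank1_lattice a (b_at t) (b_at t * c_at u + \<alpha>)"

text \<open>Any upper bound for the left-hand sides of \<open>coeff_bound_ge\<close> would do.\<close>

definition coeff_bound :: int where
  "coeff_bound = 3 * (1 + a) * (1 + \<alpha> + \<beta> + \<gamma>)"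

lemma coeff_bound_ge:
  "1 + a \<le> coeff_bound" "2 * a \<le> coeff_bound" "\<alpha> + 1 \<le> coeff_bound" "1 + 2 * \<beta> \<le> coeff_bound"
  "a * (\<alpha> + 1) \<le> coeff_bound" "\<alpha> * (1 + a) \<le> coeff_bound"
  "2 * a + \<beta> * (1 + a) \<le> a * coeff_bound" "2 * a + \<alpha> * (1 + a) \<le> a * coeff_bound"
  "a + \<alpha> * (1 + a) + \<gamma> * (2 * a) \<le> a * coeff_bound"
proof -
  have nonneg: "0 \<le> a * \<alpha>" "0 \<le> a * \<beta>" "0 \<le> a * \<gamma>"
    using a_ge_1 \<alpha>_ge_1 \<beta>_nonneg \<gamma>_nonneg by simp_all
  have expanded: "coeff_bound = 3 * (1 + a + \<alpha> + \<beta> + \<gamma> + a * \<alpha> + a * \<beta> + a * \<gamma>)"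
    by (simp add: coeff_bound_def algebra_simps)
  note bounds = nonneg expanded a_ge_1 \<alpha>_ge_1 \<beta>_nonneg \<gamma>_nonneg
  show "1 + a \<le> coeff_bound" "2 * a \<le> coeff_bound" "\<alpha> + 1 \<le> coeff_bound"
    "1 + 2 * \<beta> \<le> coeff_bound" "a * (\<alpha> + 1) \<le> coeff_bound" "\<alpha> * (1 + a) \<le> coeff_bound"
    using bounds by (simp_all add: algebra_simps)
  have "0 \<le> coeff_bound"
    using bounds by simp
  then have "coeff_bound \<le> a * coeff_bound"
    using mult_right_mono[OF a_ge_1] by simp
  moreover have "2 * a + \<beta> * (1 + a) \<le> coeff_bound" "2 * a + \<alpha> * (1 + a) \<le> coeff_bound"
    "a + \<alpha> * (1 + a) + \<gamma> * (2 * a) \<le> coeff_bound"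
    using bounds by (simp_all add: algebra_simps)
  ultimately show "2 * a + \<beta> * (1 + a) \<le> a * coeff_bound"
    "2 * a + \<alpha> * (1 + a) \<le> a * coeff_bound"
    "a + \<alpha> * (1 + a) + \<gamma> * (2 * a) \<le> a * coeff_bound"
    by linarith+
qed

lemma l_affine_of_al_bk_le:
  assumes al_bk: "\<bar>a * l - b_at t * k\<bar> \<le> 2 * a" and k: "\<bar>k\<bar> \<le> 1 + a"
  shows "l \<in> bounded_affine_values coeff_bound t"
proof (rule bounded_affine_valuesI)
  show "\<bar>l - \<alpha> * k * t\<bar> \<le> coeff_bound"
    by (rule abs_le_of_combination[of a _ 1 "a * l - b_at t * k" \<beta> k, OF _ _ _ _ al_bk k])
      (use a_ge_1 \<beta>_nonneg coeff_bound_ge in \<open>simp_all add: b_at_def algebra_simps\<close>)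
  have "\<bar>\<alpha> * k\<bar> \<le> \<alpha> * (1 + a)"
    using \<alpha>_ge_1 k by (simp add: abs_mult)
  then show "\<bar>\<alpha> * k\<bar> \<le> coeff_bound"
    using coeff_bound_ge by linarith
qed

lemma l_affine_of_x3_le:
  assumes x3: "\<bar>b_at t * n + \<alpha> * l\<bar> \<le> \<alpha>" and n: "\<bar>n\<bar> \<le> \<alpha> + 1"
  shows "l \<in> bounded_affine_values coeff_bound t"
proof (rule bounded_affine_valuesI)
  have "\<bar>l - (- (a * n)) * t\<bar> \<le> 1 + 2 * \<beta>"
  proof (rule abs_le_of_combination[of \<alpha> _ 1 "b_at t * n + \<alpha> * l" \<beta> "- n" \<alpha> "\<alpha> + 1"])
    have "\<beta> \<le> \<alpha> * \<beta>"
      using mult_right_mono[OF \<alpha>_ge_1 \<beta>_nonneg] by simp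
    then show "1 * \<alpha> + \<beta> * (\<alpha> + 1) \<le> \<alpha> * (1 + 2 * \<beta>)"
      by (simp add: algebra_simps)
  qed (use \<alpha>_ge_1 \<beta>_nonneg x3 n in \<open>simp_all add: b_at_def algebra_simps\<close>)
  then show "\<bar>l - (- (a * n)) * t\<bar> \<le> coeff_bound"
    using coeff_bound_ge by linarith
  have "\<bar>- (a * n)\<bar> \<le> a * (\<alpha> + 1)"
    using a_ge_1 n by (simp add: abs_mult)
  then show "\<bar>- (a * n)\<bar> \<le> coeff_bound"
    using coeff_bound_ge by linarith
qed

lemma n_le_of_an_\<alpha>k_le:
  assumes an_\<alpha>k: "\<bar>a * n + \<alpha> * k\<bar> \<le> 2 * a" and k: "\<bar>k\<bar> \<le> 1 + a"
  shows "\<bar>n\<bar> \<le> coeff_bound"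
  by (rule abs_le_of_combination[of a _ 1 "a * n + \<alpha> * k" \<alpha> "- k" "2 * a" "1 + a"])
    (use a_ge_1 \<alpha>_ge_1 an_\<alpha>k k coeff_bound_ge in auto)

lemma n_affine_of_x2_le:
  assumes x2: "\<bar>a * (n - c_at u * l) + (b_at t * c_at u + \<alpha>) * k\<bar> \<le> a"
    and al_bk: "\<bar>a * l - b_at t * k\<bar> \<le> 2 * a" and k: "\<bar>k\<bar> \<le> 1 + a"
  shows "n \<in> bounded_affine_values coeff_bound u"
proof (rule bounded_affine_valuesI)
  let ?x2 = "a * (n - c_at u * l) + (b_at t * c_at u + \<alpha>) * k" and ?q = "a * l - b_at t * k"
  have x2_k: "\<bar>?x2 - \<alpha> * k\<bar> \<le> a + \<alpha> * (1 + a)"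
    by (rule abs_le_of_combination[of 1 _ 1 ?x2 \<alpha> "- k", OF _ _ _ _ x2])
      (use \<alpha>_ge_1 k in auto)
  show "\<bar>n - ?q * u\<bar> \<le> coeff_bound"
    by (rule abs_le_of_combination[of a _ 1 "?x2 - \<alpha> * k" \<gamma> ?q, OF _ _ _ _ x2_k al_bk])
      (use a_ge_1 \<gamma>_nonneg coeff_bound_ge in \<open>simp_all add: c_at_def algebra_simps\<close>)
  show "\<bar>?q\<bar> \<le> coeff_bound"
    using al_bk coeff_bound_ge by linarith
qed

lemma relative_minimum_coefficients:
  assumes b: "\<alpha> \<le> b_at t" and c: "1 \<le> c_at u"
    and min: "\<bar>lattice_vector a \<alpha> (b_at t) (c_at u) n l k\<bar> \<in> vrm (abs_set (lattice_at t u))"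
  shows "n \<in> bounded_affine_values coeff_bound u \<and> l \<in> bounded_affine_values coeff_bound t
    \<and> \<bar>k\<bar> \<le> coeff_bound"
proof -
  interpret x: relative_minimum a \<alpha> "b_at t" "c_at u" n l k
    using a_ge_1 \<alpha>_ge_1 b c min by unfold_locales (simp_all add: lattice_at_def)
  note k = x.k_le
  have "n \<in> bounded_affine_values coeff_bound u \<and> l \<in> bounded_affine_values coeff_bound t"
  proof (cases rule: x.cases)
    case x3_le_\<alpha>
    then have "l \<in> bounded_affine_values coeff_bound t"
      by (intro l_affine_of_x3_le) (simp_all add: x.x3_def)
    then show ?thesis
      using x3_le_\<alpha> coeff_bound_ge by (simp add: bounded_affine_values_const)
  next
    case x2_le_a
    then have "n \<in> bounded_affine_values coeff_bound u"
      using k by (intro n_affine_of_x2_le) (simp_all add: x.x2_def x.x1_def x.N_def)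
    then show ?thesis
      using x2_le_a l_affine_of_al_bk_le k by blast
  next
    case x2_le_ac
    then show ?thesis
      using n_le_of_an_\<alpha>k_le l_affine_of_al_bk_le k bounded_affine_values_const by blast
  next
    case x1_le_c
    then have "\<bar>n\<bar> \<le> coeff_bound" "\<bar>l\<bar> \<le> coeff_bound"
      using coeff_bound_ge a_ge_1 by linarith+
    then show ?thesis
      by (simp add: bounded_affine_values_const)
  qed
  then show ?thesis
    using k coeff_bound_ge by linarith
qed

definition candidate :: "int \<Rightarrow> int \<Rightarrow> coefficients \<Rightarrow> real^3" where
  "candidate t u = (\<lambda>((n0, n1), (l0, l1), k).
     lattice_vector a \<alpha> (b_at t) (c_at u) (n0 + n1 * u) (l0 + l1 * t) k)"

definition coefficient_box :: "coefficients set" where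
  "coefficient_box = {((n0, n1), (l0, l1), k). \<bar>n0\<bar> \<le> coeff_bound \<and> \<bar>n1\<bar> \<le> coeff_bound
     \<and> \<bar>l0\<bar> \<le> coeff_bound \<and> \<bar>l1\<bar> \<le> coeff_bound \<and> \<bar>k\<bar> \<le> coeff_bound}"

lemma finite_coefficient_box: "finite coefficient_box"
proof (rule finite_subset)
  let ?I = "{- coeff_bound..coeff_bound}"
  show "coefficient_box \<subseteq> (?I \<times> ?I) \<times> (?I \<times> ?I) \<times> ?I"
    by (auto simp: coefficient_box_def)
qed simp

lemma candidate_zero:
  shows "((0, 0), (0, 0), 0) \<in> coefficient_box" and "candidate t u ((0, 0), (0, 0), 0) = 0"
  using coeff_bound_ge a_ge_1
  by (simp_all add: coefficient_box_def candidate_def lattice_vector_def int_vec3_eq_0_iff)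

lemma candidate_in_lattice: "candidate t u j \<in> lattice_at t u"
  unfolding lattice_at_def rank1_lattice_eq_lattice_vectors candidate_def
  by (auto split: prod.split)

lemma vrm_candidates:
  assumes "\<alpha> \<le> b_at t" "1 \<le> c_at u"
  shows "vrm (abs_set (candidate t u ` coefficient_box)) = vrm (abs_set (lattice_at t u))"
proof (rule vrm_eq_between[OF abs_set_nonneg])
  show "x $ i \<in> \<int>" if "x \<in> abs_set (lattice_at t u)" for x i
    using that int_vec3_nth_Ints
    by (auto simp: abs_set_eq lattice_at_def rank1_lattice_eq abs_int_vec3)
  show "abs_set (candidate t u ` coefficient_box) \<subseteq> abs_set (lattice_at t u)"
    using candidate_in_lattice by (auto simp: abs_set_eq)
  show "vrm (abs_set (lattice_at t u)) \<subseteq> abs_set (candidate t u ` coefficient_box)"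
  proof
    fix v assume v: "v \<in> vrm (abs_set (lattice_at t u))"
    then have "v \<in> abs_set (lattice_at t u)"
      using vrm_subset by blast
    then obtain n l k where "v \<noteq> 0" and v_eq: "v = \<bar>lattice_vector a \<alpha> (b_at t) (c_at u) n l k\<bar>"
      unfolding abs_set_eq lattice_at_def rank1_lattice_eq_lattice_vectors by blast
    obtain n0 n1 l0 l1 where "n = n0 + n1 * u" "l = l0 + l1 * t"
      and coeffs: "((n0, n1), (l0, l1), k) \<in> coefficient_box"
      using relative_minimum_coefficients[OF assms v[unfolded v_eq]]
      unfolding bounded_affine_values_def coefficient_box_def by auto
    then have "v = \<bar>candidate t u ((n0, n1), (l0, l1), k)\<bar>"
      by (simp add: v_eq candidate_def)
    with coeffs \<open>v \<noteq> 0\<close> show "v \<in> abs_set (candidate t u ` coefficient_box)"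
      by (auto simp: abs_set_eq)
  qed
qed

lemma MV_lattice_eq_MV_candidates:
  assumes "\<alpha> \<le> b_at t" "1 \<le> c_at u"
  shows "MV_lattice (lattice_at t u) = MV (abs_set (candidate t u ` coefficient_box))"
  unfolding MV_lattice_def vrm_candidates[OF assms, symmetric] MV_vrm ..

section \<open>Stabilization\<close>

lemma n_affine_in_c_at:
  "real_of_int (n0 + n1 * u) = (n0 - n1 * \<gamma> / a) + n1 / a * c_at u"
  using a_ge_1 by (simp add: c_at_def field_simps)

lemma l_affine_in_b_at:
  "real_of_int (l0 + l1 * t) = (l0 - l1 * \<beta> / (\<alpha> * a)) + l1 / (\<alpha> * a) * b_at t"
  using a_ge_1 \<alpha>_ge_1 by (simp add: b_at_def field_simps)

lemma candidate_nth_in_affine_span: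
  fixes t u :: "'p \<Rightarrow> int"
  defines "X \<equiv> \<lambda>p. real_of_int (b_at (t p))" and "Y \<equiv> \<lambda>p. real_of_int (c_at (u p))"
  shows "(\<lambda>p. candidate (t p) (u p) j $ 1) \<in> affine_span Y (\<lambda>p. X p * Y p)"
    and "(\<lambda>p. candidate (t p) (u p) j $ 2) \<in> affine_span Y (\<lambda>p. X p * Y p)"
    and "(\<lambda>p. candidate (t p) (u p) j $ 3) \<in> affine_span X (\<lambda>p. X p * Y p)"
proof -
  obtain n0 n1 l0 l1 k where j: "j = ((n0, n1), (l0, l1), k)"
    by (metis prod.exhaust)
  define A B A' B' where "A = n0 - n1 * \<gamma> / a" and "B = n1 / a"
    and "A' = l0 - l1 * \<beta> / (\<alpha> * a)" and "B' = l1 / (\<alpha> * a)"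
  have n: "real_of_int (n0 + n1 * u p) = A + B * Y p" for p
    unfolding A_def B_def Y_def by (rule n_affine_in_c_at)
  have l: "real_of_int (l0 + l1 * t p) = A' + B' * X p" for p
    unfolding A'_def B'_def X_def by (rule l_affine_in_b_at)
  have nth1: "candidate (t p) (u p) j $ 1 = A + B * Y p - Y p * (A' + B' * X p)" for p
    unfolding n[symmetric] l[symmetric] by (simp add: candidate_def j lattice_vector_def Y_def)
  have nth2: "candidate (t p) (u p) j $ 2
      = a * (candidate (t p) (u p) j $ 1) + (X p * Y p + \<alpha>) * k" for p
    by (simp add: candidate_def j lattice_vector_def X_def Y_def)
  have nth3: "candidate (t p) (u p) j $ 3 = X p * (A + B * Y p) + \<alpha> * (A' + B' * X p)" for p
    unfolding n[symmetric] l[symmetric] by (simp add: candidate_def j lattice_vector_def X_def)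
  show "(\<lambda>p. candidate (t p) (u p) j $ 1) \<in> affine_span Y (\<lambda>p. X p * Y p)"
    by (rule affine_spanI[where A = A and B = "B - A'" and C = "- B'"])
      (simp add: nth1 algebra_simps)
  show "(\<lambda>p. candidate (t p) (u p) j $ 2) \<in> affine_span Y (\<lambda>p. X p * Y p)"
    by (rule affine_spanI[where A = "a * A + \<alpha> * k" and B = "a * (B - A')" and C = "k - a * B'"])
      (simp add: nth2 nth1 algebra_simps)
  show "(\<lambda>p. candidate (t p) (u p) j $ 3) \<in> affine_span X (\<lambda>p. X p * Y p)"
    by (rule affine_spanI[where A = "\<alpha> * A'" and B = "A + \<alpha> * B'" and C = B])
      (simp add: nth3 algebra_simps)
qed

definition eventually_comparable :: "'p filter \<Rightarrow> ('p \<Rightarrow> int) \<Rightarrow> ('p \<Rightarrow> int) \<Rightarrow> bool" where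
  "eventually_comparable F t u \<longleftrightarrow>
     (let X = \<lambda>p. real_of_int (b_at (t p)); Y = \<lambda>p. real_of_int (c_at (u p))
      in sgn_eventually_constant F (affine_span X (\<lambda>p. X p * Y p)) \<and>
         sgn_eventually_constant F (affine_span Y (\<lambda>p. X p * Y p)))"

lemma candidate_comparison_eventually_constant:
  assumes "eventually_comparable F t u"
  shows "eventually_constant F
    (\<lambda>p. \<bar>candidate (t p) (u p) j\<bar> $ i \<le> \<bar>candidate (t p) (u p) j'\<bar> $ i)"
proof -
  let ?X = "\<lambda>p. real_of_int (b_at (t p))" and ?Y = "\<lambda>p. real_of_int (c_at (u p))"
  have "sgn_eventually_constant F (affine_span ?X (\<lambda>p. ?X p * ?Y p))"
    and "sgn_eventually_constant F (affine_span ?Y (\<lambda>p. ?X p * ?Y p))"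
    using assms by (simp_all add: eventually_comparable_def Let_def)
  note abs_le = this[THEN eventually_constant_abs_le]
  note nth = candidate_nth_in_affine_span[of t u]
  have "\<forall>i. eventually_constant F
      (\<lambda>p. \<bar>candidate (t p) (u p) j $ i\<bar> \<le> \<bar>candidate (t p) (u p) j' $ i\<bar>)"
    unfolding forall_3
    using abs_le(2)[OF nth(1) nth(1)] abs_le(2)[OF nth(2) nth(2)] abs_le(1)[OF nth(3) nth(3)]
    by blast
  then show ?thesis
    by (simp add: abs_vec_def)
qed

lemma eventually_MV_lattice_equivalent:
  assumes comparable: "eventually_comparable F t u"
    and large: "\<forall>\<^sub>F p in F. \<alpha> < b_at (t p) \<and> 1 \<le> c_at (u p)"
  shows "\<forall>\<^sub>F (p, q) in F \<times>\<^sub>F F. combinatorially_equivalent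
    (MV_lattice (lattice_at (t p) (u p))) (MV_lattice (lattice_at (t q) (u q)))"
proof -
  let ?e = "\<lambda>p. candidate (t p) (u p)"
  let ?le = "\<lambda>p j j' i. \<bar>?e p j\<bar> $ i \<le> \<bar>?e p j'\<bar> $ i"
  have "\<forall>\<^sub>F (p, q) in F \<times>\<^sub>F F. ?le p j j' i = ?le q j j' i" for i j j'
    using candidate_comparison_eventually_constant[OF comparable]
    unfolding eventually_constant_def .
  then have "\<forall>\<^sub>F pq in F \<times>\<^sub>F F. \<forall>j\<in>coefficient_box. \<forall>j'\<in>coefficient_box. \<forall>i.
      ?le (fst pq) j j' i = ?le (snd pq) j j' i"
    unfolding case_prod_unfold
    by (intro eventually_ball_finite finite_coefficient_box ballI eventually_all_finite)
  with eventually_prodI[OF large large] show ?thesis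
  proof eventually_elim
    case (elim pq)
    obtain p q where pq: "pq = (p, q)"
      by fastforce
    have le_iff: "?le p j j' i \<longleftrightarrow> ?le q j j' i"
      if "j \<in> coefficient_box" "j' \<in> coefficient_box" for i j j'
      using elim that by (simp add: pq)
    have "?e p j = 0 \<longleftrightarrow> ?e q j = 0" if "j \<in> coefficient_box" for j
      using le_iff[OF that candidate_zero(1)]
      by (simp add: candidate_zero(2) vec_eq_iff abs_vec_def)
    then have "combinatorially_equivalent (MV (abs_set (?e p ` coefficient_box)))
        (MV (abs_set (?e q ` coefficient_box)))"
      using le_iff by (intro MV_equivalent_of_indexed)
    then show ?case
      using elim by (simp add: pq MV_lattice_eq_MV_candidates)
  qed
qed

lemma eventually_b_at_gt:
  assumes "filterlim t at_top F"
  shows "\<forall>\<^sub>F p in F. \<alpha> < b_at (t p)"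
  using eventually_gt_of_int_affine[OF assms, of "\<alpha> * a" \<alpha> \<beta>] a_ge_1 \<alpha>_ge_1 by (simp add: b_at_def)

lemma eventually_c_at_ge_1:
  assumes "filterlim u at_top F"
  shows "\<forall>\<^sub>F p in F. 1 \<le> c_at (u p)"
  using eventually_gt_of_int_affine[OF assms, of a 0 \<gamma>] a_ge_1
  by (simp add: c_at_def int_one_le_iff_zero_less)

lemma filterlim_b_at:
  "filterlim t at_top F \<Longrightarrow> filterlim (\<lambda>p. real_of_int (b_at (t p))) at_top F"
  unfolding b_at_def using a_ge_1 \<alpha>_ge_1 by (intro filterlim_of_int_affine) simp_all

lemma filterlim_c_at:
  "filterlim u at_top F \<Longrightarrow> filterlim (\<lambda>p. real_of_int (c_at (u p))) at_top F"
  unfolding c_at_def using a_ge_1 by (intro filterlim_of_int_affine) simp_all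

lemma eventually_comparable_at_top:
  assumes "filterlim t at_top F" "filterlim u at_top F"
  shows "eventually_comparable F t u"
  using sgn_eventually_constant_product[OF filterlim_b_at filterlim_c_at, OF assms]
    sgn_eventually_constant_product[OF filterlim_c_at filterlim_b_at, OF assms(2,1)]
  by (simp add: eventually_comparable_def mult.commute)

lemma eventually_comparable_fixed_u:
  assumes "filterlim t at_top F"
  shows "eventually_comparable F t (\<lambda>p. u)"
proof -
  let ?X = "\<lambda>p. real_of_int (b_at (t p))" and ?y = "real_of_int (c_at u)"
  note linear = sgn_eventually_constant_linear_functions[OF filterlim_b_at[OF assms]]
  have "sgn_eventually_constant F (affine_span ?X (\<lambda>p. ?X p * ?y))"
    by (rule linear[of _ 0 1 _ 0 ?y]) simp_all
  moreover have "sgn_eventually_constant F (affine_span (\<lambda>p. ?y) (\<lambda>p. ?X p * ?y))"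
    by (rule linear[of _ ?y 0 _ 0 ?y]) simp_all
  ultimately show ?thesis
    by (simp add: eventually_comparable_def)
qed

lemma eventually_comparable_fixed_t:
  assumes "filterlim u at_top F"
  shows "eventually_comparable F (\<lambda>p. t) u"
proof -
  let ?x = "real_of_int (b_at t)" and ?Y = "\<lambda>p. real_of_int (c_at (u p))"
  note linear = sgn_eventually_constant_linear_functions[OF filterlim_c_at[OF assms]]
  have "sgn_eventually_constant F (affine_span (\<lambda>p. ?x) (\<lambda>p. ?x * ?Y p))"
    by (rule linear[of _ ?x 0 _ 0 ?x]) simp_all
  moreover have "sgn_eventually_constant F (affine_span ?Y (\<lambda>p. ?x * ?Y p))"
    by (rule linear[of _ 0 1 _ 0 ?x]) simp_all
  ultimately show ?thesis
    by (simp add: eventually_comparable_def)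
qed

lemma tu_stabilization:
  "\<exists>t0 u0. \<alpha> < b_at (int t0) \<and> (\<forall>t u. t > t0 \<and> u > u0 \<longrightarrow> combinatorially_equivalent
     (MV_lattice (lattice_at (int t) (int u))) (MV_lattice (lattice_at (int t0) (int u0))))"
proof -
  let ?F = "sequentially \<times>\<^sub>F sequentially" and ?\<Gamma> = "\<lambda>p. lattice_at (int (fst p)) (int (snd p))"
  have t: "filterlim (\<lambda>p. int (fst p)) at_top ?F" and u: "filterlim (\<lambda>p. int (snd p)) at_top ?F"
    by (rule filterlim_compose[OF filterlim_int_sequentially] filterlim_fst filterlim_snd)+
  have large: "\<forall>\<^sub>F p in ?F. \<alpha> < b_at (int (fst p)) \<and> 1 \<le> c_at (int (snd p))"
    using eventually_b_at_gt[OF t] eventually_c_at_ge_1[OF u] by (rule eventually_conj)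
  obtain Q where Q: "eventually Q ?F" "\<And>p q. Q p \<Longrightarrow> Q q \<Longrightarrow>
      combinatorially_equivalent (MV_lattice (?\<Gamma> p)) (MV_lattice (?\<Gamma> q))"
    using eventually_MV_lattice_equivalent[OF eventually_comparable_at_top[OF t u] large]
    unfolding eventually_prod_same prod.case by blast
  obtain n where "\<And>t u. t \<ge> n \<Longrightarrow> u \<ge> n \<Longrightarrow> Q (t, u) \<and> \<alpha> < b_at (int t)"
    using eventually_conj[OF Q(1) large] unfolding eventually_prod_sequentially by auto
  then show ?thesis
    using Q(2) by (intro exI[of _ n]) fastforce
qed

lemma t_stabilization:
  assumes "0 \<le> u"
  shows "\<exists>t0. \<alpha> < b_at (int t0) \<and> (\<forall>t>t0. combinatorially_equivalent
     (MV_lattice (lattice_at (int t) u)) (MV_lattice (lattice_at (int t0) u)))"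
proof (rule sequentially_stabilizes)
  note b_large = eventually_b_at_gt[OF filterlim_int_sequentially]
  show "\<forall>\<^sub>F t in sequentially. \<alpha> < b_at (int t)"
    by (rule b_large)
  show "\<forall>\<^sub>F (s, t) in sequentially \<times>\<^sub>F sequentially. combinatorially_equivalent
      (MV_lattice (lattice_at (int s) u)) (MV_lattice (lattice_at (int t) u))"
  proof (cases "1 \<le> c_at u")
    case True
    then show ?thesis
      using b_large by (intro eventually_MV_lattice_equivalent eventually_comparable_fixed_u
          filterlim_int_sequentially) simp
  next
    case False
    moreover have "0 \<le> c_at u"
      using assms a_ge_1 \<gamma>_nonneg by (simp add: c_at_def)
    ultimately have "c_at u = 0"
      by linarith
    moreover have "\<alpha> dvd b_at s - b_at t" for s t
      by (simp add: b_at_def)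
    ultimately have "lattice_at s u = lattice_at t u" for s t
      unfolding lattice_at_def by (simp add: rank1_lattice_cong[of \<alpha> "b_at s" "b_at t"])
    then have "combinatorially_equivalent
        (MV_lattice (lattice_at s u)) (MV_lattice (lattice_at t u))" for s t
      by (metis combinatorially_equivalent_refl)
    then show ?thesis
      by (simp add: case_prod_unfold)
  qed
qed

lemma u_stabilization:
  assumes "\<alpha> < b_at t"
  shows "\<exists>u0. \<forall>u>u0. combinatorially_equivalent
     (MV_lattice (lattice_at t (int u))) (MV_lattice (lattice_at t (int u0)))"
proof -
  have "\<forall>\<^sub>F (u, v) in sequentially \<times>\<^sub>F sequentially. combinatorially_equivalent
      (MV_lattice (lattice_at t (int u))) (MV_lattice (lattice_at t (int v)))"
    using eventually_c_at_ge_1[OF filterlim_int_sequentially] assms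
    by (intro eventually_MV_lattice_equivalent eventually_comparable_fixed_t
        filterlim_int_sequentially) simp
  then show ?thesis
    using sequentially_stabilizes[where P = "\<lambda>_. True"] by force
qed

end

theorem theorem4p7:
  fixes a \<alpha> \<beta> \<gamma> :: int
    and b :: "nat \<Rightarrow> int" and N :: "nat \<Rightarrow> nat \<Rightarrow> int"
  assumes "1 \<le> a" and "1 \<le> \<alpha>"
    and "0 \<le> \<beta>" and "\<beta> < \<alpha> * a"
    and "0 \<le> \<gamma>" and "\<gamma> < a"
    and "gcd \<alpha> \<beta> = 1" and "gcd a (\<alpha> + \<beta> * \<gamma>) = 1"
    and b: "\<And>t. b t = \<alpha> * a * int t + \<beta>"
    and N: "\<And>t u. N t u = b t * (a * int u + \<gamma>) + \<alpha>"
  shows "(\<exists>t0 u0. \<alpha> < b t0 \<and>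
            (\<forall>t u. t > t0 \<and> u > u0 \<longrightarrow>
               combinatorially_equivalent
                 (MV_lattice (rank1_lattice a (b t) (N t u)))
                 (MV_lattice (rank1_lattice a (b t0) (N t0 u0)))))
       \<and> (\<forall>u. \<exists>t0. \<alpha> < b t0 \<and>
            (\<forall>t>t0.
               combinatorially_equivalent
                 (MV_lattice (rank1_lattice a (b t) (N t u)))
                 (MV_lattice (rank1_lattice a (b t0) (N t0 u)))))
       \<and> (\<forall>t. \<alpha> < b t \<longrightarrow>
            (\<exists>u0. \<forall>u>u0.
               combinatorially_equivalent
                 (MV_lattice (rank1_lattice a (b t) (N t u)))
                 (MV_lattice (rank1_lattice a (b t) (N t u0)))))"
proof -
  interpret lattice_family a \<alpha> \<beta> \<gamma>
    using assms by unfold_locales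
  have lattice: "rank1_lattice a (b t) (N t u) = lattice_at (int t) (int u)"
    and b_at: "b t = b_at (int t)" for t u
    by (simp_all add: lattice_at_def b_at_def c_at_def b N)
  show ?thesis
    unfolding lattice unfolding b_at
    by (intro conjI allI impI tu_stabilization t_stabilization u_stabilization of_nat_0_le_iff)
qed

end
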